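(* Let $p\ge 3$ be an integer and let $C_p$ be the cycle of length $p$. Then $\beta(F_2(C_p))=\big\lfloor p\lfloor p/2\rfloor/2\big\rfloor$.
   Context: For a simple finite graph $G$, the $2$-token graph $F_2(G)$ is the graph whose vertices are all $2$-element subsets of $V(G)$, two such subsets being adjacent iff their symmetric difference is an edge of $G$. $\beta(H)$ denotes the independence number of a graph $H$. *)

theory Defs
  imports "HOL-Library.Ramsey"
begin

text \<open>A graph is a pair of a vertex set and a set of edges, each edge being a 2-element set of
  vertices.\<close>

type_synonym 'a graph = "'a set \<times> 'a set set"

abbreviation verts :: "'a graph \<Rightarrow> 'a set" where
  "verts G \<equiv> fst G"

abbreviation edges :: "'a graph \<Rightarrow> 'a set set" where
  "edges G \<equiv> snd G"

definition finite_simple_graph :: "'a graph \<Rightarrow> bool" where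
  "finite_simple_graph G \<longleftrightarrow> finite (verts G) \<and> edges G \<subseteq> [verts G]\<^bsup>2\<^esup>"

definition token_graph2 :: "'a graph \<Rightarrow> 'a set graph" where
  "token_graph2 G =
     ([verts G]\<^bsup>2\<^esup>,
      {{A, B} | A B. A \<in> [verts G]\<^bsup>2\<^esup> \<and> B \<in> [verts G]\<^bsup>2\<^esup> \<and> sym_diff A B \<in> edges G})"

definition independent_set :: "'a graph \<Rightarrow> 'a set \<Rightarrow> bool" where
  "independent_set G S \<longleftrightarrow> S \<subseteq> verts G \<and> indep S (edges G)"

definition independence_number :: "'a graph \<Rightarrow> nat" where
  "independence_number G = Max {card S | S. independent_set G S}"

definition cycle_graph :: "nat \<Rightarrow> nat graph" where
  "cycle_graph p = ({0..<p}, {{i, (i + 1) mod p} | i. i < p})"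

lemma finite_simple_graph_cycle_graph:
  assumes "p \<ge> 3"
  shows "finite_simple_graph (cycle_graph p)"
proof -
  have "(i + 1) mod p < p \<and> i \<noteq> (i + 1) mod p" if "i < p" for i
    using that assms by (cases "i + 1 = p") auto
  then show ?thesis
    by (fastforce simp: finite_simple_graph_def cycle_graph_def nsets_def card_insert_if)
qed

lemma finite_simple_graph_token_graph2:
  assumes "finite_simple_graph G"
  shows "finite_simple_graph (token_graph2 G)"
proof -
  have "A \<noteq> B" if "sym_diff A B \<in> edges G" for A B
    using that assms by (auto simp: finite_simple_graph_def nsets_def)
  then show ?thesis
    using assms
    by (fastforce simp: finite_simple_graph_def token_graph2_def finite_imp_finite_nsets
        nsets_def[of "nsets _ _"] card_insert_if)
qed

end

theory Submission
  imports Defs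
begin

text \<open>For the upper bound, fix one token at \<open>i\<close>: the positions of the other token form an
  independent set of the path \<open>C\<^sub>p - i\<close> on \<open>p - 1\<close> vertices, so \<open>i\<close> lies in at most \<open>\<lfloor>p/2\<rfloor>\<close>
  members of an independent set \<open>S\<close>; summing over \<open>i\<close> counts every member of \<open>S\<close> twice.

  For the lower bound with \<open>p\<close> even, take all pairs of opposite parity. If \<open>p = 2k + 1\<close>, take all
  pairs whose cyclic distance is odd and less than \<open>k\<close>, and for odd \<open>k\<close> add the pairs
  \<open>{i, i + k}\<close> with \<open>i < k\<close>, which are independent in the \<open>p\<close>-cycle formed by the pairs at
  distance \<open>k\<close>.\<close>

lemma token_graph2_edge_iff:
  "{A, B} \<in> edges (token_graph2 G) \<longleftrightarrow>
     A \<in> [verts G]\<^bsup>2\<^esup> \<and> B \<in> [verts G]\<^bsup>2\<^esup> \<and> sym_diff A B \<in> edges G"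
  by (auto simp: token_graph2_def doubleton_eq_iff Un_commute)

text \<open>Disjoint pairs would have a symmetric difference of four elements, so \<open>A\<close>
  and \<open>B\<close> share a token \<open>c\<close>, and the other token moves between
  \<open>x\<close> and \<open>y\<close>. The disjunction covers the two directions of the
  move.\<close>

lemma sym_diff_nsets2_doubleton:
  assumes "A \<in> [V]\<^bsup>2\<^esup>" "B \<in> [V]\<^bsup>2\<^esup>" "sym_diff A B = {x, y}" "x \<noteq> y"
  obtains c where "c \<noteq> x" "c \<noteq> y" "A = {c, x} \<and> B = {c, y} \<or> A = {c, y} \<and> B = {c, x}"
proof -
  obtain a b where A: "A = {a, b}" "a \<noteq> b"
    using assms(1) by (auto simp: nsets_def card_2_iff)
  obtain c d where B: "B = {c, d}" "c \<noteq> d"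
    using assms(2) by (auto simp: nsets_def card_2_iff)
  have "A \<inter> B \<noteq> {}"
  proof
    assume "A \<inter> B = {}"
    then have "A \<subseteq> {x, y}" "B \<subseteq> {x, y}" using assms(3) by auto
    then show False using A B \<open>A \<inter> B = {}\<close> by auto
  qed
  then obtain e where e: "e \<in> A" "e \<in> B" by auto
  obtain a' where a': "A = {e, a'}" "a' \<noteq> e" using e A by auto
  obtain b' where b': "B = {e, b'}" "b' \<noteq> e" using e B by auto
  have "e \<noteq> x" "e \<noteq> y" using e assms(3) by auto
  have "a' \<noteq> b'" using assms(3) a' b' by auto
  then have "{a', b'} = {x, y}" using assms(3) a' b' by auto
  then show thesis
    using that[of e] a' b' \<open>e \<noteq> x\<close> \<open>e \<noteq> y\<close> by (auto simp: doubleton_eq_iff)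
qed

lemma Suc_mod_neq_self:
  fixes i p :: nat
  assumes "i < p" "p \<ge> 2"
  shows "i \<noteq> (i + 1) mod p"
  using assms by (cases "i + 1 = p") auto

text \<open>The blocks {1, 2}, {3, 4}, ... cover {1..<n}; there are \<open>n div 2\<close> of them,
  the last possibly a singleton, and \<open>D\<close> meets each at most once. The map
  \<open>(d - 1) div 2\<close> numbers the blocks.\<close>

lemma card_no_consecutive_le:
  fixes D :: "nat set"
  assumes "D \<subseteq> {1..<n}" and "\<And>d. d \<in> D \<Longrightarrow> Suc d \<notin> D"
  shows "card D \<le> n div 2"
proof -
  have "inj_on (\<lambda>d. (d - 1) div 2) D"
  proof (rule inj_onI)
    fix x y assume *: "x \<in> D" "y \<in> D" "(x - 1) div 2 = (y - 1) div 2"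
    moreover have "x \<ge> 1" "y \<ge> 1" using * assms(1) by auto
    ultimately have "x = y \<or> x = Suc y \<or> y = Suc x" by presburger
    then show "x = y" using * assms(2) by blast
  qed
  moreover have "(\<lambda>d. (d - 1) div 2) ` D \<subseteq> {..<n div 2}"
  proof (rule image_subsetI)
    fix d assume "d \<in> D"
    then have "1 \<le> d" "d < n" using assms(1) by auto
    then show "(d - 1) div 2 \<in> {..<n div 2}" unfolding lessThan_iff by presburger
  qed
  ultimately show ?thesis
    by (metis card_inj_on_le card_lessThan finite_lessThan)
qed

lemma card_members_containing_le:
  assumes "p \<ge> 3" and S: "independent_set (token_graph2 (cycle_graph p)) S" and "i < p"
  shows "card {A \<in> S. i \<in> A} \<le> p div 2"
proof -
  \<comment> \<open>Measuring the second token by its forward offset \<open>d\<close> from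
    \<open>i\<close> turns the path \<open>C_p - i\<close> into {1..<p}, with neighbours at
    consecutive offsets.\<close>
  define f where "f d = {i, (i + d) mod p}" for d
  define D where "D = {d \<in> {1..<p}. f d \<in> S}"
  have S_sub: "S \<subseteq> [{0..<p}]\<^bsup>2\<^esup>" and S_indep: "indep S (edges (token_graph2 (cycle_graph p)))"
    using S by (auto simp: independent_set_def token_graph2_def cycle_graph_def)
  have neq: "(i + d) mod p \<noteq> i" if "d \<in> {1..<p}" for d
  proof (cases "i + d < p")
    case False
    then have "(i + d) mod p = i + d - p"
      using that \<open>i < p\<close> by (simp add: mod_if)
    then show ?thesis using that False by auto
  qed (use that in auto)
  have "{A \<in> S. i \<in> A} \<subseteq> f ` D"
  proof clarify
    fix A assume A: "A \<in> S" "i \<in> A"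
    then have "A \<subseteq> {0..<p}" "card A = 2"
      using S_sub by (auto simp: nsets_def)
    then obtain j where j: "A = {i, j}" "j \<noteq> i" "j < p"
      using \<open>i \<in> A\<close> by (auto simp: card_2_iff doubleton_eq_iff)
    define d where "d = (if i < j then j - i else p + j - i)"
    have "d \<in> {1..<p}" "(i + d) mod p = j"
      using j \<open>i < p\<close> by (auto simp: d_def)
    then show "A \<in> f ` D"
      using A j by (intro image_eqI[of _ _ d]) (auto simp: f_def D_def)
  qed
  moreover have "Suc d \<notin> D" if "d \<in> D" for d
  proof
    assume Sd: "Suc d \<in> D"
    define x where "x = (i + d) mod p"
    define y where "y = (i + Suc d) mod p"
    have y: "y = (x + 1) mod p" by (simp add: x_def y_def mod_Suc_eq)
    have "x < p" using \<open>p \<ge> 3\<close> by (simp add: x_def)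
    have ne: "x \<noteq> i" "y \<noteq> i" "x \<noteq> y"
      using neq[of d] neq[of "Suc d"] that Sd Suc_mod_neq_self[OF \<open>x < p\<close>] \<open>p \<ge> 3\<close> y
      by (auto simp: x_def y_def D_def)
    have in_S: "{i, x} \<in> S" "{i, y} \<in> S"
      using that Sd by (auto simp: D_def f_def x_def y_def)
    have "sym_diff {i, x} {i, y} = {x, y}" using ne by auto
    then have "sym_diff {i, x} {i, y} \<in> edges (cycle_graph p)"
      using \<open>x < p\<close> y by (auto simp: cycle_graph_def)
    then have "{{i, x}, {i, y}} \<in> edges (token_graph2 (cycle_graph p))"
      unfolding token_graph2_edge_iff using in_S[THEN subsetD[OF S_sub]]
      by (simp add: cycle_graph_def)
    moreover have "{i, x} \<noteq> {i, y}" using ne by (auto simp: doubleton_eq_iff)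
    ultimately show False using S_indep in_S by (auto simp: indep_def)
  qed
  then have "card D \<le> p div 2"
    by (intro card_no_consecutive_le) (auto simp: D_def)
  moreover have "finite D" by (simp add: D_def)
  ultimately show ?thesis
    by (meson card_image_le card_mono finite_imageI order_trans)
qed

lemma finite_independent_set:
  assumes "finite_simple_graph G" "independent_set G S"
  shows "finite S"
  using assms finite_subset by (auto simp: independent_set_def finite_simple_graph_def)

lemma card_independent_set_le:
  assumes "p \<ge> 3" and S: "independent_set (token_graph2 (cycle_graph p)) S"
  shows "card S \<le> (p * (p div 2)) div 2"
proof -
  have "finite S"
    using finite_independent_set S finite_simple_graph_token_graph2
      finite_simple_graph_cycle_graph[OF \<open>p \<ge> 3\<close>] by blast
  have "card {i \<in> {..<p}. i \<in> A} = 2" if "A \<in> S" for A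
  proof -
    have "A \<in> [{0..<p}]\<^bsup>2\<^esup>"
      using S that by (auto simp: independent_set_def token_graph2_def cycle_graph_def)
    then have "{i \<in> {..<p}. i \<in> A} = A" "card A = 2" by (auto simp: nsets_def)
    then show ?thesis by simp
  qed
  then have "2 * card S = (\<Sum>i<p. card {A \<in> S. i \<in> A})"
    using \<open>finite S\<close> by (intro sum_multicount[symmetric]) auto
  also have "\<dots> \<le> (\<Sum>i<p. p div 2)"
    by (intro sum_mono card_members_containing_le assms) auto
  finally show ?thesis by simp
qed

text \<open>One token \<open>c\<close> stays fixed while the other crosses an edge; treating the
  edge from \<open>p - 1\<close> to \<open>0\<close> separately frees later arguments from
  \<open>mod\<close>.\<close>

lemma independent_set_token_cycleI:
  assumes "p \<ge> 3" and sub: "S \<subseteq> [{0..<p}]\<^bsup>2\<^esup>"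
    and step: "\<And>c x. \<lbrakk>x + 1 < p; {c, x} \<in> S; {c, x + 1} \<in> S\<rbrakk> \<Longrightarrow> False"
    and wrap: "\<And>c. \<lbrakk>{c, p - 1} \<in> S; {c, 0} \<in> S\<rbrakk> \<Longrightarrow> False"
  shows "independent_set (token_graph2 (cycle_graph p)) S"
proof -
  have "False" if AB: "A \<in> S" "B \<in> S" "{A, B} \<in> edges (token_graph2 (cycle_graph p))" for A B
  proof -
    obtain x where x: "x < p" "sym_diff A B = {x, (x + 1) mod p}"
      using AB(3) by (auto simp: token_graph2_edge_iff cycle_graph_def)
    then have neq: "x \<noteq> (x + 1) mod p"
      using \<open>p \<ge> 3\<close> by (intro Suc_mod_neq_self) auto
    have "A \<in> [{0..<p}]\<^bsup>2\<^esup>" "B \<in> [{0..<p}]\<^bsup>2\<^esup>" using AB sub by auto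
    then obtain c where "A = {c, x} \<and> B = {c, (x + 1) mod p} \<or> A = {c, (x + 1) mod p} \<and> B = {c, x}"
      by (rule sym_diff_nsets2_doubleton[OF _ _ x(2) neq])
    then have "{c, x} \<in> S" "{c, (x + 1) mod p} \<in> S" using AB by auto
    moreover have "x + 1 < p \<or> x = p - 1 \<and> (x + 1) mod p = 0"
      using x(1) by (cases "x + 1 = p") auto
    ultimately show False using step[of x c] wrap[of c] by auto
  qed
  then have "indep S (edges (token_graph2 (cycle_graph p)))"
    unfolding indep_def by blast
  then show ?thesis
    using sub by (simp add: independent_set_def token_graph2_def cycle_graph_def)
qed

text \<open>Moving one token along an edge flips its parity, also across the closing edge because
  \<open>p - 1\<close> is odd, so two adjacent pairs cannot both be of mixed parity.\<close>

lemma exists_independent_set_even: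
  assumes "p = 2 * k" "k \<ge> 2"
  shows "\<exists>S. independent_set (token_graph2 (cycle_graph p)) S \<and> card S = k * k"
proof -
  define f where "f = (\<lambda>(a, b). {2 * a, 2 * b + 1 :: nat})"
  define S where "S = f ` ({..<k} \<times> {..<k})"
  have parity: "even x \<longleftrightarrow> odd y" if "{x, y} \<in> S" for x y
    using that by (auto simp: S_def f_def doubleton_eq_iff)
  have "independent_set (token_graph2 (cycle_graph p)) S"
  proof (rule independent_set_token_cycleI)
    have "2 * a \<noteq> 2 * b + 1" for a b :: nat by presburger
    then show "S \<subseteq> [{0..<p}]\<^bsup>2\<^esup>"
      using assms by (auto simp: S_def f_def nsets_def card_insert_if)
    show False if "{c, p - 1} \<in> S" "{c, 0} \<in> S" for c
      using parity[OF that(1)] parity[OF that(2)] assms by simp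
    show False if "{c, x} \<in> S" "{c, x + 1} \<in> S" for c x
      using parity[OF that(1)] parity[OF that(2)] by simp
  qed (use assms in auto)
  moreover have "inj_on f ({..<k} \<times> {..<k})"
    by (rule inj_onI) (auto simp: f_def doubleton_eq_iff, presburger+)
  then have "card S = k * k" by (simp add: S_def card_image)
  ultimately show ?thesis by blast
qed

lemma exists_independent_set_odd:
  assumes p: "p = 2 * k + 1" and "k \<ge> 1"
  shows "\<exists>S. independent_set (token_graph2 (cycle_graph p)) S \<and> card S = (p * k) div 2"
proof -
  \<comment> \<open>A difference \<open>d\<close> stands for cyclic distance
    \<open>min d (p - d)\<close>. As \<open>p\<close> is odd, an even \<open>d > k + 1\<close> means
    that \<open>p - d\<close> is odd and less than \<open>k\<close>.\<close>
  define Q where "Q d \<longleftrightarrow> odd d \<and> d < k \<or> even d \<and> d > k + 1" for d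
  define P where "P i j \<longleftrightarrow> i < j \<and> j < p \<and> (Q (j - i) \<or> odd k \<and> j = i + k \<and> i < k)" for i j
  \<comment> \<open>\<open>R\<close> drops the restriction \<open>i < k\<close> from
    \<open>P\<close>, leaving a condition on the difference alone: odd up to \<open>k\<close>, or
    even above \<open>k + 1\<close>. Leaving out \<open>k + 1\<close> keeps successors
    apart.\<close>
  define R where "R d \<longleftrightarrow> Q d \<or> odd k \<and> d = k" for d
  have R_Suc: "\<not> R (Suc d)" if "R d" for d
    using that unfolding R_def Q_def by auto
  \<comment> \<open>Crossing the closing edge replaces the difference \<open>2 * k - c\<close> by
    \<open>c\<close>. These have equal parity, so both lie in the same range of \<open>R\<close>;
    their sum \<open>2 * k\<close> then forces both to be \<open>k\<close>.\<close>
  have R_compl: "d = k" if "R d" "R (2 * k - d)" "d \<le> 2 * k" for d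
  proof -
    have "even (2 * k - d) \<longleftrightarrow> even d" using that(3) by simp
    then show ?thesis using that unfolding R_def Q_def by auto
  qed
  have P_R: "R (j - i)" if "P i j" for i j
    using that by (auto simp: P_def R_def)
  define f where "f = (\<lambda>(i, j). {i, j :: nat})"
  define T where "T = {(i, j). P i j}"
  define S where "S = f ` T"
  have "T \<subseteq> {..<p} \<times> {..<p}" by (auto simp: T_def P_def)
  then have "finite T" by (rule finite_subset) simp
  have memb: "{x, y} \<in> S \<longleftrightarrow> P x y \<or> P y x" for x y
    by (auto simp: S_def f_def T_def doubleton_eq_iff image_iff)
  have indep: "independent_set (token_graph2 (cycle_graph p)) S"
  proof (rule independent_set_token_cycleI)
    show "S \<subseteq> [{0..<p}]\<^bsup>2\<^esup>"
      by (auto simp: S_def f_def T_def P_def nsets_def card_insert_if)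
    show False if "{c, p - 1} \<in> S" "{c, 0} \<in> S" for c
    proof -
      have P: "P c (2 * k)" "P 0 c"
        using that p by (auto simp: memb P_def)
      then have "c = k"
        using R_compl[of c] P_R[OF P(1)] P_R[OF P(2)] p by (simp add: P_def)
      \<comment> \<open>Here \<open>i < k\<close> matters: it excludes the pair {k, 2k}, the only
        conflict that \<open>R\<close> does not rule out.\<close>
      then show False
        using P(1) by (auto simp: P_def Q_def)
    qed
    show False if "{c, x} \<in> S" "{c, x + 1} \<in> S" for c x
    proof (cases "c < x")
      case True
      then have "R (x - c)" "R (Suc (x - c))"
        using that P_R[of c x] P_R[of c "x + 1"] by (auto simp: memb P_def Suc_diff_le)
      then show False using R_Suc by blast
    next
      case False
      then have "x + 1 < c"
        using that by (auto simp: memb P_def)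
      then have "R (c - (x + 1))" "R (Suc (c - (x + 1)))"
        using that P_R[of x c] P_R[of "x + 1" c] by (auto simp: memb P_def Suc_diff_Suc)
      then show False using R_Suc by blast
    qed
  qed (use assms in auto)
  have "inj_on f T"
    by (rule inj_onI) (auto simp: f_def T_def P_def doubleton_eq_iff)
  then have card_S: "card S = card T" by (simp add: S_def card_image)
  \<comment> \<open>\<open>g\<close> starts at \<open>i\<close>, goes \<open>2 * e + 1\<close> steps
    forward and lists the smaller end first. This length is below \<open>k\<close> on
    \<open>U\<close>, hence less than half of \<open>p\<close>, so the pair determines its starting
    end and \<open>g\<close> is injective.\<close>
  define g where "g = (\<lambda>(i, e). let j = i + 2 * e + 1 in if j < p then (i, j) else (j - p, i))"
  define U where "U = {..<p} \<times> {..<k div 2}"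
  define W where "W = (if odd k then (\<lambda>i. (i, i + k)) ` {..<k} else {})"
  have "inj_on g U"
  proof (rule inj_onI, clarify)
    fix i e i' e' assume "(i, e) \<in> U" "(i', e') \<in> U" "g (i, e) = g (i', e')"
    then show "i = i' \<and> e = e'"
      using p by (auto simp: g_def U_def Let_def split: if_splits)
  qed
  \<comment> \<open>Differences in \<open>W\<close> equal \<open>k\<close>; those from
    \<open>g\<close> are below \<open>k\<close> or above \<open>k + 1\<close>.\<close>
  moreover have "g ` U \<inter> W = {}"
    using p by (auto simp: g_def U_def W_def Let_def split: if_splits)
  moreover have "card W = (if odd k then k else 0)"
    by (simp add: W_def card_image inj_on_def)
  ultimately have "card (g ` U \<union> W) = p * (k div 2) + (if odd k then k else 0)"
    by (subst card_Un_disjoint) (auto simp: U_def W_def card_image)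
  \<comment> \<open>For odd \<open>k\<close>, since \<open>2 * k = p - 1\<close>, the sum is
    \<open>(p * k - 1) / 2\<close>, the rounded-down half.\<close>
  also have "\<dots> = (p * k) div 2"
    using p by (cases "even k") (auto elim!: evenE oddE simp: algebra_simps)
  finally have "card (g ` U \<union> W) = (p * k) div 2" .
  moreover have "g (i, e) \<in> T" if "i < p" "e < k div 2" for i e
  proof -
    have "Suc (2 * e) < k" using that(2) by linarith
    then show ?thesis
      using that(1) p by (cases "i + 2 * e + 1 < p") (auto simp: g_def T_def P_def Q_def Let_def)
  qed
  then have "g ` U \<subseteq> T" by (auto simp: U_def)
  moreover have "W \<subseteq> T"
    using p by (auto simp: W_def T_def P_def)
  ultimately have "(p * k) div 2 \<le> card S"
    using card_mono[OF \<open>finite T\<close>, of "g ` U \<union> W"] card_S by simp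
  \<comment> \<open>The constructed pairs bound \<open>card S\<close> from below only; the general
    upper bound closes the gap.\<close>
  moreover have "card S \<le> (p * k) div 2"
    using card_independent_set_le[OF _ indep] assms by simp
  ultimately show ?thesis using indep by auto
qed

theorem theorem1p3:
  fixes p :: nat
  assumes "p \<ge> 3"
  shows "independence_number (token_graph2 (cycle_graph p)) = (p * (p div 2)) div 2"
proof -
  let ?G = "token_graph2 (cycle_graph p)"
  have "\<exists>S. independent_set ?G S \<and> card S = (p * (p div 2)) div 2"
  proof (cases "even p")
    case True
    then obtain k where "p = 2 * k" by blast
    then show ?thesis using exists_independent_set_even[of p k] assms by simp
  next
    case False
    then obtain k where "p = 2 * k + 1" by (elim oddE)
    then show ?thesis using exists_independent_set_odd[of p k] assms by simp
  qed
  \<comment> \<open>The upper bound also makes the set of cardinalities finite, as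
    \<open>Max\<close> requires.\<close>
  moreover have "{card S | S. independent_set ?G S} \<subseteq> {..(p * (p div 2)) div 2}"
    using card_independent_set_le[OF assms] by auto
  then have "finite {card S | S. independent_set ?G S}"
    using finite_subset by blast
  ultimately show ?thesis
    unfolding independence_number_def
    using card_independent_set_le[OF assms] by (intro Max_eqI) force+
qed

end
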